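(* Suppose that $(g^i,h^i)$, $i=1,2$, are admissible constraint pairs. Given $s^i\in D[0,\infty)$, let $(x^i,k^i)$ be the solution to the Skorokhod problem $\mathbb{SP}_{g^i}^{h^i}(s^i)$, $i=1,2$. Then, for every $T>0$, $$\sup_{t\in[0,T]}|k^1_t-k^2_t|\leq \sup_{t\in[0,T]}|s^1_t-s^2_t|+\sup_{t\in[0,T]}(\bar{g}_t\vee\bar{h}_t),$$ where $\bar{g}_t:=|(g^1)^{-1}(t,0)-(g^2)^{-1}(t,0)|$ and $\bar{h}_t:=|(h^1)^{-1}(t,0)-(h^2)^{-1}(t,0)|$.
   Context: $D[0,\infty)$ is the set of real-valued càdlàg functions on $[0,\infty)$, and $BV[0,\infty)\subset D[0,\infty)$ the subset of functions of bounded variation. $a\vee b=\max(a,b)$. Admissible constraint pair: functions $g,h:[0,\infty)\times\mathbb{R}\to\mathbb{R}$ such that (i) for each fixed $x\in\mathbb{R}$, $g(\cdot,x),h(\cdot,x)\in D[0,\infty)$; (ii) for any fixed $t\ge0$, $g(t,\cdot)$ and $h(t,\cdot)$ are strictly increasing, and $g(t,x)<h(t,x)$ for any $(t,x)\in[0,\infty)\times\mathbb{R}$; (iii) for any $t\geq 0$, the inverses $g^{-1}(t,0)$ and $h^{-1}(t,0)$ (the points at which $g(t,\cdot)$, respectively $h(t,\cdot)$, vanish) exist, $g^{-1}(\cdot,0),h^{-1}(\cdot,0)\in D[0,\infty)$, and $\inf_{t\geq 0}(g^{-1}(t,0)-h^{-1}(t,0))>0$. Skorokhod problem: given $s\in D[0,\infty)$,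 a pair $(x,k)\in D[0,\infty)\times BV[0,\infty)$ solves the Skorokhod problem for $s$ with nonlinear constraints $g,h$, written $(x,k)=\mathbb{SP}_g^h(s)$, if for all $t\ge 0$: (i) $x_t=s_t+k_t$; (ii) $g(t,x_t)\le 0\le h(t,x_t)$; (iii) $k_{0-}=0$ and $k$ has a decomposition $k=k^h-k^g$ with $k^h,k^g$ nondecreasing functions satisfying $$\int_0^\infty I_{\{g(u,x_u)<0\}}\,dk^g_u=0,\qquad \int_0^\infty I_{\{h(u,x_u)>0\}}\,dk^h_u=0.$$ Conventions: $k_{0-}=k^h_{0-}=k^g_{0-}=0$, and the integrals over $[0,\infty)$ include the possible atoms at time $0$ of sizes $k^g_0$ and $k^h_0$. For an admissible constraint pair the solution exists and is unique. *)

theory Defs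
  imports "HOL-Analysis.Analysis"
begin

text \<open>
  Functions on \<open>[0,\<infinity>)\<close> are modelled by functions on \<open>real\<close> whose values at negative
  arguments are irrelevant.
\<close>

definition cadlag :: "(real \<Rightarrow> real) \<Rightarrow> bool" where
  "cadlag f \<longleftrightarrow>
     (\<forall>t\<ge>0. continuous (at_right t) f) \<and> (\<forall>t>0. \<exists>l. (f \<longlongrightarrow> l) (at_left t))"

definition bounded_variation_on :: "real set \<Rightarrow> (real \<Rightarrow> real) \<Rightarrow> bool" where
  "bounded_variation_on S f \<longleftrightarrow>
     (\<exists>B. \<forall>n (p :: nat \<Rightarrow> real). mono p \<and> range p \<subseteq> S \<longrightarrow>
        (\<Sum>i<n. \<bar>f (p (Suc i)) - f (p i)\<bar>) \<le> B)"

text \<open>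
  \<open>BV[0,\<infinity>)\<close> is understood locally, i.e. as finite variation on each \<open>[0,T]\<close>: with finite total
  variation on all of \<open>[0,\<infinity>)\<close> a solution would not exist for every cadlag input.
\<close>

definition cadlag_bv :: "(real \<Rightarrow> real) \<Rightarrow> bool" where
  "cadlag_bv k \<longleftrightarrow> cadlag k \<and> (\<forall>T>0. bounded_variation_on {0..T} k)"

text \<open>
  In \<open>admissible\<close>, \<open>inv (g t) 0\<close> is the point \<open>g\<^sup>-\<^sup>1(t,0)\<close>; it is unique by strict monotonicity.
  Since \<open>g < h\<close>, the differences \<open>g\<^sup>-\<^sup>1(t,0) - h\<^sup>-\<^sup>1(t,0)\<close> are positive, so the real-valued
  infimum is that of a nonempty set bounded below.
\<close>

definition admissible :: "(real \<Rightarrow> real \<Rightarrow> real) \<Rightarrow> (real \<Rightarrow> real \<Rightarrow> real) \<Rightarrow> bool" where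
  "admissible g h \<longleftrightarrow>
     (\<forall>x. cadlag (\<lambda>t. g t x) \<and> cadlag (\<lambda>t. h t x)) \<and>
     (\<forall>t\<ge>0. strict_mono (g t) \<and> strict_mono (h t) \<and> (\<forall>x. g t x < h t x)) \<and>
     (\<forall>t\<ge>0. (\<exists>x. g t x = 0) \<and> (\<exists>x. h t x = 0)) \<and>
     cadlag (\<lambda>t. inv (g t) 0) \<and> cadlag (\<lambda>t. inv (h t) 0) \<and>
     (INF t\<in>{0..}. inv (g t) 0 - inv (h t) 0) > 0"

text \<open>
  The convention \<open>F\<^sub>0\<^sub>- = 0\<close>: extending \<open>F\<close> by \<open>0\<close> to the negative half-line makes \<open>F\<close>
  nondecreasing from \<open>0-\<close> on (so \<open>F 0 \<ge> 0\<close>) and gives the measure \<open>dF\<close> an atom of mass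
  \<open>F 0\<close> at time \<open>0\<close>.
\<close>

definition extend_zero :: "(real \<Rightarrow> real) \<Rightarrow> real \<Rightarrow> real" where
  "extend_zero F t = (if t < 0 then 0 else F t)"

definition stieltjes :: "(real \<Rightarrow> real) \<Rightarrow> real measure" where
  "stieltjes F = interval_measure (extend_zero F)"

text \<open>
  The components \<open>kh\<close>, \<open>kg\<close> are cadlag so that \<open>stieltjes\<close> is their Lebesgue--Stieltjes measure.
  This is no restriction: since \<open>kh - kg\<close> is right-continuous, \<open>kh\<close> and \<open>kg\<close> could fail to be
  right-continuous only at common jumps, where both integrands would have to vanish; that is
  impossible because \<open>g < h\<close>.

  By strict monotonicity, \<open>g u (x u) < 0\<close> means \<open>x u < inv (g u) 0\<close>, so for admissible constraints
  the integrands are Borel measurable on \<open>[0,\<infinity>)\<close>.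
\<close>

definition skorokhod_solution ::
  "(real \<Rightarrow> real \<Rightarrow> real) \<Rightarrow> (real \<Rightarrow> real \<Rightarrow> real) \<Rightarrow>
   (real \<Rightarrow> real) \<Rightarrow> (real \<Rightarrow> real) \<Rightarrow> (real \<Rightarrow> real) \<Rightarrow> bool" where
  "skorokhod_solution g h s x k \<longleftrightarrow>
     cadlag x \<and> cadlag_bv k \<and>
     (\<forall>t\<ge>0. x t = s t + k t) \<and>
     (\<forall>t\<ge>0. g t (x t) \<le> 0 \<and> 0 \<le> h t (x t)) \<and>
     (\<exists>kh kg. cadlag kh \<and> cadlag kg \<and>
        mono (extend_zero kh) \<and> mono (extend_zero kg) \<and>
        (\<forall>t\<ge>0. k t = kh t - kg t) \<and>
        (\<integral>\<^sup>+u\<in>{0..}. indicator {v. g v (x v) < 0} u \<partial>stieltjes kg) = 0 \<and>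
        (\<integral>\<^sup>+u\<in>{0..}. indicator {v. h v (x v) > 0} u \<partial>stieltjes kh) = 0)"

end

theory Submission
  imports Defs
begin

text \<open>
  The map \<open>g\<^sup>-\<^sup>1(t,0)\<close> is an upper barrier for \<open>x\<close> and \<open>h\<^sup>-\<^sup>1(t,0)\<close> a lower one; \<open>k\<^sup>h\<close> grows only while
  \<open>x\<close> sits on the lower barrier, \<open>k\<^sup>g\<close> only while \<open>x\<close> sits on the upper one.  Let \<open>S\<close> bound
  \<open>s\<^sup>2 - s\<^sup>1\<close> and let \<open>R\<close> bound the distances between corresponding barriers.  At a time when
  \<open>D = k\<^sup>1 - k\<^sup>2\<close> exceeds \<open>S + R\<close>, the difference \<open>x\<^sup>1 - x\<^sup>2\<close> exceeds \<open>R\<close>; then \<open>x\<^sup>1\<close> is strictly above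
  its lower barrier and \<open>x\<^sup>2\<close> strictly below its upper barrier
  (lemma \<open>off_barriers_if_far_apart\<close>).  Hence neither of the two forces that could push \<open>D\<close>
  upwards is active, and \<open>D\<close> cannot increase as long as it stays above \<open>S + R\<close>.  Since
  \<open>D\<^sub>0\<^sub>- = 0\<close>, it would have to enter the region above the level.  It cannot do so right after a
  time \<open>\<tau>\<close> with \<open>D\<^sub>\<tau> \<le> S + R\<close>, because there is no growth after \<open>\<tau>\<close>; and it cannot jump into
  the region at \<open>\<tau>\<close>, because the atom producing the jump would sit at a time when \<open>D\<close> is already
  above the level.

  In lemma \<open>skorokhod_difference_le\<close> this is the case distinction on whether the supremum \<open>\<tau>\<close> of
  the times before \<open>t\<close> with \<open>D \<le> S + R\<close> is attained.  Exchanging the two problems gives the bound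
  for \<open>\<bar>D\<bar>\<close>.  The suprema in the conclusion really are upper bounds because cadlag functions
  are bounded on compact intervals.
\<close>

section \<open>Boundedness of cadlag functions\<close>

lemma cadlag_locally_bounded:
  assumes f: "cadlag f" and "x \<ge> 0"
  shows "\<exists>d>0. \<exists>B. \<forall>y\<ge>0. \<bar>y - x\<bar> < d \<longrightarrow> \<bar>f y\<bar> \<le> B"
proof -
  have "(f \<longlongrightarrow> f x) (at_right x)"
    using f \<open>x \<ge> 0\<close> by (simp add: cadlag_def continuous_within)
  then have "\<forall>\<^sub>F y in at_right x. dist (f y) (f x) < 1"
    by (rule tendstoD) simp
  then obtain b where b: "b > x" "\<And>y. x < y \<Longrightarrow> y < b \<Longrightarrow> dist (f y) (f x) < 1"
    by (auto simp: eventually_at_right_field)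
  obtain a l where a: "a < x" "\<And>y. y \<ge> 0 \<Longrightarrow> a < y \<Longrightarrow> y < x \<Longrightarrow> dist (f y) l < 1"
  proof (cases "x = 0")
    case True
    then show ?thesis using that[of "-1" 0] by auto
  next
    case False
    then obtain l where "(f \<longlongrightarrow> l) (at_left x)"
      using f \<open>x \<ge> 0\<close> unfolding cadlag_def by (metis order_le_less)
    then have "\<forall>\<^sub>F y in at_left x. dist (f y) l < 1"
      by (rule tendstoD) simp
    then show ?thesis using that by (auto simp: eventually_at_left_field)
  qed
  have "\<bar>f y\<bar> \<le> \<bar>f x\<bar> + \<bar>l\<bar> + 1" if "y \<ge> 0" "\<bar>y - x\<bar> < min (b - x) (x - a)" for y
  proof (cases y x rule: linorder_cases)
    case less
    then show ?thesis using a(2)[of y] that by (auto simp: dist_real_def)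
  next
    case equal
    then show ?thesis by simp
  next
    case greater
    then show ?thesis using b(2)[of y] that by (auto simp: dist_real_def)
  qed
  moreover have "min (b - x) (x - a) > 0" using a b by simp
  ultimately show ?thesis by blast
qed

lemma cadlag_bounded_on_interval:
  assumes f: "cadlag f" and "T \<ge> 0"
  shows "\<exists>B. \<forall>y\<in>{0..T}. \<bar>f y\<bar> \<le> B"
proof -
  \<comment> \<open>The guard \<open>y \<ge> 0\<close> is for the bisection principle, whose local hypothesis also covers
    intervals reaching below \<open>0\<close>, where a cadlag function is arbitrary.\<close>
  define P where "P a b \<longleftrightarrow> (\<exists>B. \<forall>y\<in>{a..b}. y \<ge> 0 \<longrightarrow> \<bar>f y\<bar> \<le> B)" for a b
  have "P 0 T"
  proof (rule Bolzano[of 0 T P])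
    fix a b c
    assume "P a b" "P b c"
    then obtain B C where "\<forall>y\<in>{a..b}. y \<ge> 0 \<longrightarrow> \<bar>f y\<bar> \<le> B" "\<forall>y\<in>{b..c}. y \<ge> 0 \<longrightarrow> \<bar>f y\<bar> \<le> C"
      by (auto simp: P_def)
    then have "\<forall>y\<in>{a..c}. y \<ge> 0 \<longrightarrow> \<bar>f y\<bar> \<le> max B C"
      by (metis atLeastAtMost_iff le_max_iff_disj linear)
    then show "P a c" unfolding P_def by blast
  next
    fix x :: real
    assume "0 \<le> x"
    from cadlag_locally_bounded[OF f this]
    obtain d B where "d > 0" and B: "\<forall>y\<ge>0. \<bar>y - x\<bar> < d \<longrightarrow> \<bar>f y\<bar> \<le> B" by blast
    have "P a b" if "a \<le> x \<and> x \<le> b \<and> b - a < d" for a b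
      unfolding P_def using B that by (intro exI[of _ B]) auto
    then show "\<exists>d>0. \<forall>a b. a \<le> x \<and> x \<le> b \<and> b - a < d \<longrightarrow> P a b"
      using \<open>d > 0\<close> by blast
  qed fact
  then show ?thesis by (auto simp: P_def)
qed

section \<open>Intervals that a Stieltjes measure does not charge\<close>

lemma emeasure_stieltjes_Ioc:
  assumes F: "cadlag F" and m: "mono (extend_zero F)" and "a \<le> b"
  shows "emeasure (stieltjes F) {a<..b} = ennreal (extend_zero F b - extend_zero F a)"
  unfolding stieltjes_def
proof (rule emeasure_interval_measure_Ioc)
  show "a \<le> b" by fact
  show "extend_zero F x \<le> extend_zero F y" if "x \<le> y" for x y
    using m that by (rule monoD)
  show "continuous (at_right x) (extend_zero F)" for x
  proof (cases "x \<ge> 0")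
    case True
    then have "(F \<longlongrightarrow> F x) (at_right x)" using F by (simp add: cadlag_def continuous_within)
    moreover have "\<forall>\<^sub>F y in at_right x. F y = extend_zero F y"
      using eventually_at_right_less by eventually_elim (use True in \<open>auto simp: extend_zero_def\<close>)
    ultimately have "(extend_zero F \<longlongrightarrow> F x) (at_right x)" by (rule Lim_transform_eventually)
    then show ?thesis using True by (simp add: continuous_within extend_zero_def)
  next
    case False
    then have "\<forall>\<^sub>F y in at_right x. y < 0"
      by (auto simp: eventually_at_right_field intro!: exI[of _ 0])
    then have "\<forall>\<^sub>F y in at_right x. 0 = extend_zero F y"
      by eventually_elim (simp add: extend_zero_def)
    then have "(extend_zero F \<longlongrightarrow> 0) (at_right x)"
      by (rule Lim_transform_eventually[OF tendsto_const])
    then show ?thesis using False by (simp add: continuous_within extend_zero_def)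
  qed
qed

text \<open>
  Only the lower integral enters, so \<open>N\<close> may be nonmeasurable: the indicator of \<open>B\<close> is a
  measurable minorant of the integrand.
\<close>

lemma emeasure_stieltjes_eq_0:
  assumes "(\<integral>\<^sup>+u\<in>{0..}. indicator N u \<partial>stieltjes F) = 0"
    and "B \<in> sets borel" "B \<subseteq> N" "B \<subseteq> {0..}"
  shows "emeasure (stieltjes F) B = 0"
proof -
  have "emeasure (stieltjes F) B = (\<integral>\<^sup>+u. indicator B u \<partial>stieltjes F)"
    using assms by (simp add: stieltjes_def)
  also have "\<dots> \<le> (\<integral>\<^sup>+u\<in>{0..}. indicator N u \<partial>stieltjes F)"
    using assms by (intro nn_integral_mono) (auto simp: indicator_def)
  finally show ?thesis using assms(1) by simp
qed

lemma no_increase_on_null_Ioc: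
  assumes "cadlag F" "mono (extend_zero F)"
    and "(\<integral>\<^sup>+u\<in>{0..}. indicator N u \<partial>stieltjes F) = 0"
    and "0 \<le> a" "a \<le> t" "{a<..t} \<subseteq> N"
  shows "extend_zero F t \<le> extend_zero F a"
proof -
  have "emeasure (stieltjes F) {a<..t} = 0"
    using assms by (intro emeasure_stieltjes_eq_0[where N = N]) auto
  then show ?thesis using assms by (simp add: emeasure_stieltjes_Ioc ennreal_eq_0_iff)
qed

text \<open>
  An uncharged closed interval has no atom at its left endpoint, so \<open>F\<close> has, up to any \<open>e\<close>, reached
  its value at \<open>t\<close> already shortly before \<open>a\<close>.  For \<open>a = 0\<close> this makes \<open>F\<close> vanish up to \<open>t\<close>, which is why the
  extension to negative times appears.
\<close>

lemma small_increase_before_null_Icc: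
  assumes F: "cadlag F" "mono (extend_zero F)"
    and N: "(\<integral>\<^sup>+u\<in>{0..}. indicator N u \<partial>stieltjes F) = 0"
    and "0 \<le> a" "a \<le> t" "{a..t} \<subseteq> N" "e > 0"
  shows "\<exists>c<a. \<forall>u>c. extend_zero F t - extend_zero F u < e"
proof -
  define c where "c n = a - 1 / real (Suc n)" for n
  have c: "c n < a" "c n \<le> t" for n
  proof -
    show "c n < a" by (simp add: c_def)
    then show "c n \<le> t" using \<open>a \<le> t\<close> by simp
  qed
  have Ioc: "emeasure (stieltjes F) {c n<..t} = ennreal (extend_zero F t - extend_zero F (c n))" for n
    using F c by (simp add: emeasure_stieltjes_Ioc)
  have "incseq c"
    unfolding c_def by (intro monoI) (simp add: frac_le)
  then have dec: "decseq (\<lambda>n. {c n<..t})"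
    by (intro antimonoI) (auto dest: monoD intro: le_less_trans)
  have inter: "(\<Inter>n. {c n<..t}) = {a..t}"
  proof (intro equalityI subsetI)
    fix y assume y: "y \<in> (\<Inter>n. {c n<..t})"
    have "c \<longlonglongrightarrow> a - 0"
      unfolding c_def by (intro tendsto_diff tendsto_const LIMSEQ_Suc[OF lim_1_over_n])
    then have "a \<le> y"
      using y by (intro LIMSEQ_le_const2[of c a y]) (auto simp: less_imp_le)
    then show "y \<in> {a..t}" using y by auto
  qed (use c in \<open>auto intro: less_le_trans\<close>)
  have "(\<lambda>n. emeasure (stieltjes F) {c n<..t}) \<longlonglongrightarrow> emeasure (stieltjes F) (\<Inter>n. {c n<..t})"
    using dec by (intro Lim_emeasure_decseq) (auto simp: Ioc, simp add: stieltjes_def)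
  moreover have "emeasure (stieltjes F) {a..t} = 0"
    using assms by (intro emeasure_stieltjes_eq_0[OF N]) auto
  ultimately have "(\<lambda>n. ennreal (extend_zero F t - extend_zero F (c n))) \<longlonglongrightarrow> 0"
    by (simp add: inter Ioc)
  then have "\<forall>\<^sub>F n in sequentially. ennreal (extend_zero F t - extend_zero F (c n)) < ennreal e"
    by (rule order_tendstoD) (use \<open>e > 0\<close> in simp)
  then obtain n where "ennreal (extend_zero F t - extend_zero F (c n)) < ennreal e"
    by (auto simp: eventually_sequentially)
  then have "extend_zero F t - extend_zero F (c n) < e"
    using \<open>e > 0\<close> by (metis ennreal_less_iff le_less_trans linear not_less)
  moreover have "extend_zero F (c n) \<le> extend_zero F u" if "u > c n" for u
    using monoD[OF F(2), of "c n" u] that by simp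
  ultimately show ?thesis using c(1)[of n] by (intro exI[of _ "c n"]) force
qed

section \<open>One-sided comparison of two Skorokhod problems\<close>

lemma inv_zero:
  assumes "strict_mono (f :: real \<Rightarrow> real)" "\<exists>x. f x = 0"
  shows "f y \<le> 0 \<longleftrightarrow> y \<le> inv f 0" "0 \<le> f y \<longleftrightarrow> inv f 0 \<le> y"
proof -
  have "f (inv f 0) = 0" using assms(2) by (metis f_inv_into_f rangeI)
  then show "f y \<le> 0 \<longleftrightarrow> y \<le> inv f 0" "0 \<le> f y \<longleftrightarrow> inv f 0 \<le> y"
    by (metis assms(1) strict_mono_less_eq)+
qed

lemma skorokhod_solutionD:
  assumes "skorokhod_solution g h s x k" "u \<ge> 0"
  shows "x u = s u + k u" "g u (x u) \<le> 0" "0 \<le> h u (x u)"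
  using assms(1)[unfolded skorokhod_solution_def, THEN conjunct2, THEN conjunct2] assms(2)
  by (elim conjE, simp)+

text \<open>
  If \<open>y1\<close> were at or below the first lower barrier, then \<open>y2 < y1 - R\<close> would fall below the second
  lower barrier, which is at most \<open>R\<close> lower than the first; dually for \<open>y2\<close> and the upper barriers.
\<close>

lemma off_barriers_if_far_apart:
  assumes "admissible g1 h1" "admissible g2 h2" "u \<ge> 0"
    and "0 \<le> h2 u y2" "g1 u y1 \<le> 0" "y1 - y2 > R"
    and "inv (g1 u) 0 - inv (g2 u) 0 \<le> R" "inv (h1 u) 0 - inv (h2 u) 0 \<le> R"
  shows "h1 u y1 > 0" "g2 u y2 < 0"
proof -
  have sm: "strict_mono (g1 u)" "strict_mono (h1 u)" "strict_mono (g2 u)" "strict_mono (h2 u)"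
    "\<exists>x. g1 u x = 0" "\<exists>x. h1 u x = 0" "\<exists>x. g2 u x = 0" "\<exists>x. h2 u x = 0"
    using assms(1-3) by (auto simp: admissible_def)
  have "y1 > inv (h1 u) 0" "y2 < inv (g2 u) 0"
    using assms(4-8) sm by (simp_all add: inv_zero)
  then show "h1 u y1 > 0" "g2 u y2 < 0"
    using inv_zero(1)[OF sm(2,6), of y1] inv_zero(2)[OF sm(3,7), of y2] by linarith+
qed

text \<open>
  Each difference is bounded on one side only, so the same lemma applied to the exchanged problems
  yields the other half of the absolute estimate.  The condition \<open>0 \<le> S + R\<close> expresses that \<open>D\<close>
  starts at \<open>D\<^sub>0\<^sub>- = 0\<close>, not above the level.
\<close>

lemma skorokhod_difference_le:
  assumes adm: "admissible g1 h1" "admissible g2 h2"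
    and sol1: "skorokhod_solution g1 h1 s1 x1 k1"
    and sol2: "skorokhod_solution g2 h2 s2 x2 k2"
    and S: "\<And>u. u \<in> {0..t} \<Longrightarrow> s2 u - s1 u \<le> S"
    and Rg: "\<And>u. u \<in> {0..t} \<Longrightarrow> inv (g1 u) 0 - inv (g2 u) 0 \<le> R"
    and Rh: "\<And>u. u \<in> {0..t} \<Longrightarrow> inv (h1 u) 0 - inv (h2 u) 0 \<le> R"
    and "0 \<le> S + R" "t \<ge> 0"
  shows "k1 t - k2 t \<le> S + R"
proof (rule ccontr)
  assume above: "\<not> k1 t - k2 t \<le> S + R"
  obtain kh1 kg1 where 1: "cadlag kh1" "mono (extend_zero kh1)" "mono (extend_zero kg1)"
      "\<And>t. t \<ge> 0 \<Longrightarrow> k1 t = kh1 t - kg1 t"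
      "(\<integral>\<^sup>+u\<in>{0..}. indicator {v. h1 v (x1 v) > 0} u \<partial>stieltjes kh1) = 0"
    using sol1 unfolding skorokhod_solution_def by auto
  obtain kh2 kg2 where 2: "cadlag kg2" "mono (extend_zero kh2)" "mono (extend_zero kg2)"
      "\<And>t. t \<ge> 0 \<Longrightarrow> k2 t = kh2 t - kg2 t"
      "(\<integral>\<^sup>+u\<in>{0..}. indicator {v. g2 v (x2 v) < 0} u \<partial>stieltjes kg2) = 0"
    using sol2 unfolding skorokhod_solution_def by auto
  define D where "D u = (if u < 0 then 0 else k1 u - k2 u)" for u
  have off: "h1 u (x1 u) > 0 \<and> g2 u (x2 u) < 0" if "0 \<le> u" "u \<le> t" "D u > S + R" for u
  proof -
    have "x1 u = s1 u + k1 u" "x2 u = s2 u + k2 u"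
      using skorokhod_solutionD[OF sol1] skorokhod_solutionD[OF sol2] that by auto
    then have "x1 u - x2 u > R"
      using that S[of u] by (auto simp: D_def)
    moreover have "g1 u (x1 u) \<le> 0" "0 \<le> h2 u (x2 u)"
      using skorokhod_solutionD[OF sol1] skorokhod_solutionD[OF sol2] that by auto
    ultimately show ?thesis
      using off_barriers_if_far_apart[OF adm, of u] Rg[of u] Rh[of u] that by simp
  qed
  \<comment> \<open>Only \<open>k\<^sup>h\<close> of the first and \<open>k\<^sup>g\<close> of the second problem can make \<open>D\<close> grow.\<close>
  have growth: "D t - D u \<le> (extend_zero kh1 t - extend_zero kh1 u)
      + (extend_zero kg2 t - extend_zero kg2 u)" if "u \<le> t" for u
  proof -
    have "D v = extend_zero kh1 v - extend_zero kg1 v - extend_zero kh2 v + extend_zero kg2 v" for v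
      using 1(4) 2(4) by (simp add: D_def extend_zero_def)
    then show ?thesis using monoD[OF 1(3) that] monoD[OF 2(2) that] by simp
  qed
  define A where "A = {u. u \<le> t \<and> D u \<le> S + R}"
  \<comment> \<open>All negative times belong to \<open>A\<close>, so a jump of \<open>D\<close> at time \<open>0\<close> is treated like any other.\<close>
  define \<tau> where "\<tau> = Sup A"
  have bdd: "bdd_above A" by (auto simp: A_def)
  have neg: "u \<in> A" if "u < 0" for u
    using that \<open>0 \<le> S + R\<close> \<open>t \<ge> 0\<close> by (simp add: A_def D_def)
  then have ne: "A \<noteq> {}" by (metis empty_iff lt_ex)
  have "\<tau> \<ge> 0"
  proof (rule ccontr)
    assume "\<not> \<tau> \<ge> 0"
    then have "\<tau> / 2 \<in> A" by (intro neg) simp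
    then show False using cSup_upper[OF _ bdd] \<open>\<not> \<tau> \<ge> 0\<close> by (fastforce simp: \<tau>_def)
  qed
  have "\<tau> \<le> t" unfolding \<tau>_def using ne by (intro cSup_least) (auto simp: A_def)
  have after: "D u > S + R" if "\<tau> < u" "u \<le> t" for u
    using cSup_upper[OF _ bdd, of u] that by (force simp: A_def \<tau>_def)
  have Dt: "D t > S + R" using above \<open>t \<ge> 0\<close> by (simp add: D_def)
  show False
  proof (cases "D \<tau> \<le> S + R")
    case True
    have "{\<tau><..t} \<subseteq> {v. h1 v (x1 v) > 0}" "{\<tau><..t} \<subseteq> {v. g2 v (x2 v) < 0}"
      using off after \<open>\<tau> \<ge> 0\<close> by auto
    then have "D t \<le> D \<tau>"
      using growth[OF \<open>\<tau> \<le> t\<close>] \<open>\<tau> \<ge> 0\<close> \<open>\<tau> \<le> t\<close>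
        no_increase_on_null_Ioc[OF 1(1,2,5), of \<tau> t]
        no_increase_on_null_Ioc[OF 2(1,3,5), of \<tau> t] by simp
    then show False using True Dt by simp
  next
    \<comment> \<open>The level is passed by a jump at \<open>\<tau>\<close>; then the relevant measures have no atom at \<open>\<tau>\<close> either,
      and times of \<open>A\<close> just before \<open>\<tau>\<close> serve as starting points.\<close>
    case False
    define e where "e = (D t - (S + R)) / 2"
    have "e > 0" using Dt by (simp add: e_def)
    have "D u > S + R" if "\<tau> \<le> u" "u \<le> t" for u
      using after[of u] False that by (cases "u = \<tau>") auto
    then have "{\<tau>..t} \<subseteq> {v. h1 v (x1 v) > 0}" "{\<tau>..t} \<subseteq> {v. g2 v (x2 v) < 0}"
      using off \<open>\<tau> \<ge> 0\<close> by auto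
    then obtain c d where "c < \<tau>" "d < \<tau>"
      and c: "\<And>u. u > c \<Longrightarrow> extend_zero kh1 t - extend_zero kh1 u < e"
      and d: "\<And>u. u > d \<Longrightarrow> extend_zero kg2 t - extend_zero kg2 u < e"
      using small_increase_before_null_Icc[OF 1(1,2,5) \<open>\<tau> \<ge> 0\<close> \<open>\<tau> \<le> t\<close> _ \<open>e > 0\<close>]
        small_increase_before_null_Icc[OF 2(1,3,5) \<open>\<tau> \<ge> 0\<close> \<open>\<tau> \<le> t\<close> _ \<open>e > 0\<close>] by blast
    then obtain u where "u \<in> A" "u > max c d"
      using less_cSup_iff[OF ne bdd, of "max c d"] by (auto simp: \<tau>_def)
    then have "D t - D u < 2 * e" "D u \<le> S + R"
      using growth[of u] c[of u] d[of u] by (auto simp: A_def)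
    then show False by (simp add: e_def)
  qed
qed

section \<open>The Lipschitz estimate\<close>

theorem proposition2p22:
  fixes g1 h1 g2 h2 :: "real \<Rightarrow> real \<Rightarrow> real"
    and s1 x1 k1 s2 x2 k2 :: "real \<Rightarrow> real"
    and T :: real
  assumes "admissible g1 h1" and "admissible g2 h2"
    and "cadlag s1" and "cadlag s2"
    and "skorokhod_solution g1 h1 s1 x1 k1"
    and "skorokhod_solution g2 h2 s2 x2 k2"
    and "T > 0"
  shows "(SUP t\<in>{0..T}. \<bar>k1 t - k2 t\<bar>) \<le>
           (SUP t\<in>{0..T}. \<bar>s1 t - s2 t\<bar>) +
           (SUP t\<in>{0..T}. max \<bar>inv (g1 t) 0 - inv (g2 t) 0\<bar>
                              \<bar>inv (h1 t) 0 - inv (h2 t) 0\<bar>)"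
proof -
  let ?s = "\<lambda>t. \<bar>s1 t - s2 t\<bar>"
  let ?r = "\<lambda>t. max \<bar>inv (g1 t) 0 - inv (g2 t) 0\<bar> \<bar>inv (h1 t) 0 - inv (h2 t) 0\<bar>"
  define S where "S = (SUP t\<in>{0..T}. ?s t)"
  define R where "R = (SUP t\<in>{0..T}. ?r t)"
  have bdd_diff: "\<exists>B. \<forall>t\<in>{0..T}. \<bar>f t - f' t\<bar> \<le> B" if f: "cadlag f" "cadlag f'" for f f'
  proof -
    obtain B B' where B: "\<forall>t\<in>{0..T}. \<bar>f t\<bar> \<le> B" "\<forall>t\<in>{0..T}. \<bar>f' t\<bar> \<le> B'"
      using cadlag_bounded_on_interval[OF f(1), of T] cadlag_bounded_on_interval[OF f(2), of T]
        \<open>T > 0\<close> by (meson less_imp_le)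
    have "\<bar>f t - f' t\<bar> \<le> B + B'" if "t \<in> {0..T}" for t
      using B[THEN bspec, OF that] by linarith
    then show ?thesis by blast
  qed
  have cad: "cadlag (\<lambda>t. inv (g1 t) 0)" "cadlag (\<lambda>t. inv (g2 t) 0)"
    "cadlag (\<lambda>t. inv (h1 t) 0)" "cadlag (\<lambda>t. inv (h2 t) 0)"
    using assms by (auto simp: admissible_def)
  have "bdd_above (?s ` {0..T})"
    using bdd_diff[OF assms(3,4)] by (auto intro: bdd_aboveI2)
  then have S: "?s t \<le> S" if "t \<in> {0..T}" for t
    unfolding S_def using that by (intro cSUP_upper)
  obtain Bg Bh where "\<forall>t\<in>{0..T}. \<bar>inv (g1 t) 0 - inv (g2 t) 0\<bar> \<le> Bg"
      "\<forall>t\<in>{0..T}. \<bar>inv (h1 t) 0 - inv (h2 t) 0\<bar> \<le> Bh"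
    using bdd_diff[OF cad(1,2)] bdd_diff[OF cad(3,4)] by blast
  then have "bdd_above (?r ` {0..T})"
    by (intro bdd_aboveI2[of _ _ "max Bg Bh"]) (meson max.mono)
  then have R: "?r t \<le> R" if "t \<in> {0..T}" for t
    unfolding R_def using that by (intro cSUP_upper)
  have "0 \<le> S" "0 \<le> R" using S[of 0] R[of 0] \<open>T > 0\<close> by auto
  then have nonneg: "0 \<le> S + R" by simp
  have "\<bar>k1 t - k2 t\<bar> \<le> S + R" if t: "t \<in> {0..T}" for t
  proof -
    have sub: "u \<in> {0..T}" if "u \<in> {0..t}" for u using that t by simp
    have "k1 t - k2 t \<le> S + R"
      by (rule skorokhod_difference_le[OF assms(1,2,5,6) _ _ _ nonneg])
        (use S[OF sub] R[OF sub] t in \<open>auto simp: abs_le_iff\<close>)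
    moreover have "k2 t - k1 t \<le> S + R"
      by (rule skorokhod_difference_le[OF assms(2,1,6,5) _ _ _ nonneg])
        (use S[OF sub] R[OF sub] t in \<open>auto simp: abs_le_iff\<close>)
    ultimately show ?thesis by simp
  qed
  then show ?thesis
    unfolding S_def[symmetric] R_def[symmetric] using \<open>T > 0\<close> by (intro cSUP_least) auto
qed

end
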